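(* Let $T>0$ and let $u:[0,T]\to\mathbb{V}\subset\mathbb{W}^*$ be a smooth solution of the evolution problem $$\mathcal{Q}(u(t))^*\,\partial_t u(t)=\mathcal{A}(u(t))\quad\text{in }\mathbb{V}^*,\qquad 0<t\le T,$$ i.e., $u$ is continuous in $t$ with respect to the norm of $\mathbb{V}$ and continuously differentiable in $t$ with respect to the norm of $\mathbb{W}^*$ (with derivative $\partial_t u(t)\in\mathbb{W}^*$); moreover, $u(t)\in\mathrm{dom}(\mathcal{A})$ and $u(t)\in\mathrm{dom}(\mathcal{E})$ for all $t$, in particular $u(0)\in\mathrm{dom}(\mathcal{E})$. Then $$\frac{d}{dt}\mathcal{E}(u(t))=-\mathcal{D}(u(t))\qquad\text{for all }0<t\le T$$ (at $t=T$ the derivatives are understood as left-sided).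
   Context: Function spaces: $\mathbb{H}$ is a real Hilbert space with scalar product $\langle\cdot,\cdot\rangle$, identified with its dual $\mathbb{H}^*$. $\mathbb{V},\mathbb{W}\subset\mathbb{H}$ are reflexive Banach spaces, continuously and densely embedded in $\mathbb{H}$. Thus $\mathbb{V}\subset\mathbb{H}\subset\mathbb{V}^*$ and $\mathbb{W}\subset\mathbb{H}\subset\mathbb{W}^*$ are evolution triples with the same pivot space. In particular $\mathbb{V}\subset\mathbb{W}^*$, where $v\in\mathbb{V}$ is identified with the functional $w\mapsto\langle v,w\rangle$ on $\mathbb{W}$. Duality pairings are written $\langle\cdot,\cdot\rangle_{\mathbb{V}^*\times\mathbb{V}}$ and $\langle\cdot,\cdot\rangle_{\mathbb{W}^*\times\mathbb{W}}$. Energy: $\mathcal{E}:\mathbb{V}\to\mathbb{R}\cup\{+\infty\}$ is convex and proper, with essential domain $\mathrm{dom}(\mathcal{E})=\{u\in\mathbb{V}:\mathcal{E}(u)<\infty\}$. It is differentiable on its domain with respect to the topology of $\mathbb{W}^*$: for every $u\in\mathrm{dom}(\mathcal{E})$ there is a derivative $\mathcal{E}'(u)\in\mathbb{W}^{**}=\mathbb{W}$ such that $\mathcal{E}(v)=\mathcal{E}(u)+\langle v-u,\mathcal{E}'(u)\rangle_{\mathbb{W}^*\times\mathbb{W}}+o(\|v-u\|_{\mathbb{W}^*})$ as $v\to u$ in $\mathbb{W}^*$, $v\in\mathrm{dom}(\mathcal{E})$. Structural assumption: for every $u\in\mathrm{dom}(\mathcal{E})$ there is a given bounded linear operator $\mathcal{Q}(u):\mathbb{V}\to\mathbb{W}$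 such that $\mathcal{E}'(u)=\mathcal{Q}(u)u$. The adjoint $\mathcal{Q}(u)^*:\mathbb{W}^*\to\mathbb{V}^*$ is the bounded linear operator defined by $\langle\mathcal{Q}(u)^*w^*,v\rangle_{\mathbb{V}^*\times\mathbb{V}}=\langle w^*,\mathcal{Q}(u)v\rangle_{\mathbb{W}^*\times\mathbb{W}}$ for all $v\in\mathbb{V}$, $w^*\in\mathbb{W}^*$. Evolution operator and dissipation: $\mathcal{A}$ is a (possibly nonlinear) densely defined operator from $\mathrm{dom}(\mathcal{A})\subset\mathbb{V}$ to $\mathbb{V}^*$, and the dissipation functional is $\mathcal{D}(u):=-\langle\mathcal{A}(u),u\rangle_{\mathbb{V}^*\times\mathbb{V}}$ for $u\in\mathrm{dom}(\mathcal{A})$. No sign condition on $\mathcal{D}$ is assumed. *)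

theory Defs
  imports "HOL-Analysis.Analysis" "HOL-Library.Landau_Symbols"
begin

definition bidual_embedding :: "'a::real_normed_vector \<Rightarrow> ('a \<Rightarrow>\<^sub>L real) \<Rightarrow>\<^sub>L real" where
  "bidual_embedding x = Blinfun (\<lambda>f. blinfun_apply f x)"

lemma blinfun_apply_bidual_embedding [simp]:
  "blinfun_apply (bidual_embedding x) f = blinfun_apply f x"
  unfolding bidual_embedding_def
  by (simp add: bounded_linear_Blinfun_apply
      bounded_bilinear.bounded_linear_left[OF bounded_bilinear_blinfun_apply])

definition reflexive_space :: "'a::real_normed_vector itself \<Rightarrow> bool" where
  "reflexive_space _ \<longleftrightarrow> surj (bidual_embedding :: 'a \<Rightarrow> ('a \<Rightarrow>\<^sub>L real) \<Rightarrow>\<^sub>L real)"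

(* The inclusion of a reflexive Banach space in the pivot space H is represented by an
   injective bounded linear map j. *)
definition evolution_triple ::
  "('x::banach \<Rightarrow>\<^sub>L 'h::{real_inner, complete_space}) \<Rightarrow> bool" where
  "evolution_triple j \<longleftrightarrow>
     reflexive_space TYPE('x) \<and> inj (blinfun_apply j) \<and> closure (range (blinfun_apply j)) = UNIV"

(* With H identified with its dual, v in V acts on W as w \<mapsto> \<langle>i v, j w\<rangle>, where i and j are the
   inclusions of V and W in H. This realises V as a subset of the dual of W. *)
definition pivot_embedding ::
  "('v::real_normed_vector \<Rightarrow>\<^sub>L 'h::real_inner) \<Rightarrow> ('w::real_normed_vector \<Rightarrow>\<^sub>L 'h) \<Rightarrow> 'v \<Rightarrow> 'w \<Rightarrow>\<^sub>L real" where
  "pivot_embedding i j v = blinfun_inner_right (blinfun_apply i v) o\<^sub>L j"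

lemma blinfun_apply_pivot_embedding [simp]:
  "blinfun_apply (pivot_embedding i j v) w = blinfun_apply i v \<bullet> blinfun_apply j w"
  by (simp add: pivot_embedding_def)

definition dual_adjoint ::
  "('a::real_normed_vector \<Rightarrow>\<^sub>L 'b::real_normed_vector) \<Rightarrow> ('b \<Rightarrow>\<^sub>L real) \<Rightarrow>\<^sub>L ('a \<Rightarrow>\<^sub>L real)" where
  "dual_adjoint B = Blinfun (\<lambda>f. f o\<^sub>L B)"

lemma blinfun_apply_dual_adjoint [simp]:
  "blinfun_apply (blinfun_apply (dual_adjoint B) f) x = blinfun_apply f (blinfun_apply B x)"
  unfolding dual_adjoint_def
  by (simp add: bounded_linear_Blinfun_apply
      bounded_bilinear.bounded_linear_left[OF bounded_bilinear_blinfun_compose])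

definition ess_domain :: "('v \<Rightarrow> ereal) \<Rightarrow> 'v set" where
  "ess_domain E = {u. E u < \<infinity>}"

definition proper_energy :: "('v \<Rightarrow> ereal) \<Rightarrow> bool" where
  "proper_energy E \<longleftrightarrow> (\<forall>u. E u \<noteq> -\<infinity>) \<and> ess_domain E \<noteq> {}"

(* The end points t = 0 and t = 1 are harmless because 0 * \<infinity> = 0 in ereal. *)
definition convex_energy :: "('v::real_vector \<Rightarrow> ereal) \<Rightarrow> bool" where
  "convex_energy E \<longleftrightarrow>
     (\<forall>u v. \<forall>t\<in>{0..1}. E ((1 - t) *\<^sub>R u + t *\<^sub>R v) \<le> ereal (1 - t) * E u + ereal t * E v)"

(* e embeds V in the dual of W. The filter describes v \<rightarrow> u in the norm of that dual
   with v in the essential domain of E, and the derivative g is an element of W, which reflexivity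
   identifies with its bidual. *)
definition has_dual_gradient ::
  "('v::real_vector \<Rightarrow> 'w::real_normed_vector \<Rightarrow>\<^sub>L real) \<Rightarrow> ('v \<Rightarrow> ereal) \<Rightarrow> 'v \<Rightarrow> 'w \<Rightarrow> bool" where
  "has_dual_gradient e E u g \<longleftrightarrow>
     (\<lambda>v. real_of_ereal (E v) - real_of_ereal (E u) - blinfun_apply (e (v - u)) g)
       \<in> o[inf (filtercomap e (nhds (e u))) (principal (ess_domain E))](\<lambda>v. norm (e (v - u)))"

definition dissipation :: "('v::real_normed_vector \<Rightarrow> 'v \<Rightarrow>\<^sub>L real) \<Rightarrow> 'v \<Rightarrow> real" where
  "dissipation A u = - blinfun_apply (A u) u"

end

theory Submission
  imports Defs
begin

text \<open>The identity is a chain rule followed by one transposition. Differentiating the energy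
  along the curve pairs the velocity \<open>du t\<close> in the dual of W with the gradient
  \<open>dE (u t)\<close> in W. Since the gradient is \<open>Q (u t)\<close> applied to
  \<open>u t\<close>, moving \<open>Q (u t)\<close> to the other side as its adjoint turns this
  pairing into that of \<open>A (u t)\<close> with \<open>u t\<close>, which is minus the
  dissipation. The analytic content lies in \<open>has_dual_gradient_chain\<close>: both the
  expansion of the energy and the derivative of the curve are measured in the dual norm of W, so
  they can be composed.\<close>

lemma pivot_embedding_diff: "pivot_embedding i j (x - y) = pivot_embedding i j x - pivot_embedding i j y"
  by (rule blinfun_eqI)
     (simp add: blinfun.diff_left blinfun.diff_right inner_diff_left)

text \<open>Dividing the first-order remainder by \<open>s - t\<close> gives exactly the error of
  the difference quotient. The quotient form is needed for curves in the dual of W.\<close>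

lemma has_vector_derivative_difference_quotient:
  fixes f :: "real \<Rightarrow> 'a::real_normed_vector"
  assumes "(f has_vector_derivative d) (at t within S)"
  shows "((\<lambda>s. (f s - f t) /\<^sub>R (s - t)) \<longlongrightarrow> d) (at t within S)"
proof -
  have "((\<lambda>s. norm (f s - f t - (s - t) *\<^sub>R d) / norm (s - t)) \<longlongrightarrow> 0) (at t within S)"
    using assms by (simp add: has_vector_derivative_def has_derivative_iff_norm)
  moreover have "\<forall>\<^sub>F s in at t within S.
      norm (f s - f t - (s - t) *\<^sub>R d) / norm (s - t) = norm ((f s - f t) /\<^sub>R (s - t) - d)"
    unfolding eventually_at_filter
  proof (intro always_eventually allI impI)
    fix s assume "s \<noteq> t"
    hence "(f s - f t) /\<^sub>R (s - t) - d = (f s - f t - (s - t) *\<^sub>R d) /\<^sub>R (s - t)"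
      by (simp add: scaleR_diff_right)
    thus "norm (f s - f t - (s - t) *\<^sub>R d) / norm (s - t) = norm ((f s - f t) /\<^sub>R (s - t) - d)"
      by (simp add: divide_inverse_commute)
  qed
  ultimately have "((\<lambda>s. norm ((f s - f t) /\<^sub>R (s - t) - d)) \<longlongrightarrow> 0) (at t within S)"
    by (rule Lim_transform_eventually)
  thus ?thesis by (simp add: tendsto_norm_zero_iff LIM_zero_iff)
qed

text \<open>Along the curve the remainder of the energy is small compared with the dual norm of the
  increment, and that norm is of order \<open>s - t\<close>. What survives in the limit is the
  linear part, the difference quotients of \<open>e\<close> along \<open>u\<close> evaluated at
  \<open>g\<close>.\<close>

lemma has_dual_gradient_chain:
  fixes e :: "'v::real_vector \<Rightarrow> 'w::real_normed_vector \<Rightarrow>\<^sub>L real" and u :: "real \<Rightarrow> 'v"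
  assumes diff: "\<And>x y. e (x - y) = e x - e y"
    and grad: "has_dual_gradient e E (u t) g"
    and deriv: "((\<lambda>s. e (u s)) has_vector_derivative d) (at t within S)"
    and dom: "\<And>s. s \<in> S \<Longrightarrow> u s \<in> ess_domain E"
  shows "((\<lambda>s. real_of_ereal (E (u s))) has_real_derivative blinfun_apply d g) (at t within S)"
proof -
  let ?F = "at t within S"
  let ?r = "\<lambda>s. real_of_ereal (E (u s)) - real_of_ereal (E (u t)) - blinfun_apply (e (u s - u t)) g"
  have quot: "((\<lambda>s. (e (u s) - e (u t)) /\<^sub>R (s - t)) \<longlongrightarrow> d) ?F"
    by (rule has_vector_derivative_difference_quotient[OF deriv])
  have "((\<lambda>s. e (u s)) \<longlongrightarrow> e (u t)) ?F"
    using has_vector_derivative_continuous[OF deriv] by (simp add: continuous_within)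
  moreover have "filterlim u (principal (ess_domain E)) ?F"
    unfolding filterlim_principal by (auto simp: eventually_at_filter dom)
  \<comment> \<open>Convergence in a \<open>filtercomap\<close> along \<open>e\<close> is
    convergence after applying \<open>e\<close>, so the two facts above are the two factors of the
    infimum.\<close>
  ultimately have lim: "filterlim u (inf (filtercomap e (nhds (e (u t)))) (principal (ess_domain E))) ?F"
    by (simp add: filterlim_inf filterlim_filtercomap_iff comp_def)
  have "?r \<in> o[?F](\<lambda>s. norm (e (u s - u t)))"
    using landau_o.small.compose[OF grad[unfolded has_dual_gradient_def] lim] .
  \<comment> \<open>The ratio converges to \<open>norm d\<close>, which may vanish; hence a big-O
    bound rather than an equivalence.\<close>
  also have "(\<lambda>s. norm (e (u s - u t))) \<in> O[?F](\<lambda>s. \<bar>s - t\<bar>)"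
  proof (rule bigoI_tendsto)
    show "((\<lambda>s. norm (e (u s - u t)) / \<bar>s - t\<bar>) \<longlongrightarrow> norm d) ?F"
      using tendsto_norm[OF quot] by (simp add: diff divide_inverse_commute)
  qed (auto simp: eventually_at_filter)
  finally have "?r \<in> o[?F](\<lambda>s. s - t)"
    by simp
  hence "((\<lambda>s. ?r s / (s - t)) \<longlongrightarrow> 0) ?F"
    by (rule smalloD_tendsto)
  moreover have "((\<lambda>s. blinfun_apply ((e (u s) - e (u t)) /\<^sub>R (s - t)) g) \<longlongrightarrow> blinfun_apply d g) ?F"
    by (intro blinfun.tendsto quot tendsto_const)
  ultimately have "((\<lambda>s. ?r s / (s - t) + blinfun_apply ((e (u s) - e (u t)) /\<^sub>R (s - t)) g)
      \<longlongrightarrow> 0 + blinfun_apply d g) ?F"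
    by (rule tendsto_add)
  \<comment> \<open>Additivity of \<open>e\<close> cancels the linear part. The case
    \<open>s = t\<close> is covered too, as division by zero yields zero on both sides.\<close>
  moreover have "?r s / (s - t) + blinfun_apply ((e (u s) - e (u t)) /\<^sub>R (s - t)) g
      = (real_of_ereal (E (u s)) - real_of_ereal (E (u t))) / (s - t)" for s
    by (simp only: diff blinfun.scaleR_left real_scaleR_def)
       (simp add: divide_inverse_commute flip: distrib_left)
  ultimately show ?thesis
    by (simp add: has_field_derivative_iff)
qed

theorem theorem1:
  fixes iV :: "'v::banach \<Rightarrow>\<^sub>L 'h::{real_inner, complete_space}"
    and iW :: "'w::banach \<Rightarrow>\<^sub>L 'h"
    and E :: "'v \<Rightarrow> ereal"
    and dE :: "'v \<Rightarrow> 'w"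
    and Q :: "'v \<Rightarrow> 'v \<Rightarrow>\<^sub>L 'w"
    and domA :: "'v set"
    and A :: "'v \<Rightarrow> 'v \<Rightarrow>\<^sub>L real"
    and T :: real
    and u :: "real \<Rightarrow> 'v"
    and du :: "real \<Rightarrow> 'w \<Rightarrow>\<^sub>L real"
  assumes "evolution_triple iV" and "evolution_triple iW"
    and "convex_energy E" and "proper_energy E"
    and "\<And>v. v \<in> ess_domain E \<Longrightarrow> has_dual_gradient (pivot_embedding iV iW) E v (dE v)"
    and "\<And>v. v \<in> ess_domain E \<Longrightarrow> dE v = blinfun_apply (Q v) v"
    and "closure domA = UNIV"
    and "T > 0"
    and "continuous_on {0..T} u"
    and "\<And>t. t \<in> {0<..T} \<Longrightarrow> ((\<lambda>s. pivot_embedding iV iW (u s)) has_vector_derivative du t)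
                                    (at t within {0..T})"
    and "continuous_on {0<..T} du"
    and "\<And>t. t \<in> {0..T} \<Longrightarrow> u t \<in> domA"
    and "\<And>t. t \<in> {0..T} \<Longrightarrow> u t \<in> ess_domain E"
    and "\<And>t. t \<in> {0<..T} \<Longrightarrow> blinfun_apply (dual_adjoint (Q (u t))) (du t) = A (u t)"
  shows "\<forall>t\<in>{0<..T}. ((\<lambda>s. real_of_ereal (E (u s))) has_real_derivative - dissipation A (u t))
           (at t within {0..T})"
proof
  fix t assume t: "t \<in> {0<..T}"
  hence dom: "u t \<in> ess_domain E" using assms(13) by auto
  have "blinfun_apply (du t) (dE (u t)) = blinfun_apply (blinfun_apply (dual_adjoint (Q (u t))) (du t)) (u t)"
    using assms(6)[OF dom] by simp
  also have "\<dots> = - dissipation A (u t)"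
    using assms(14)[OF t] by (simp add: dissipation_def)
  \<comment> \<open>The chain rule is applied on \<open>{0..T}\<close>, so the derivative at
    \<open>T\<close> is left-sided. The energy is finite along the curve, by properness and
    membership in the essential domain, so \<open>real_of_ereal\<close> loses nothing.\<close>
  finally show "((\<lambda>s. real_of_ereal (E (u s))) has_real_derivative - dissipation A (u t)) (at t within {0..T})"
    using has_dual_gradient_chain[OF pivot_embedding_diff assms(5)[OF dom] assms(10)[OF t] assms(13)]
    by simp
qed

end
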